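(* The focused sequent calculus with tags is sound and complete with respect to the (unfocused) sequent calculus for $\mathtt{SkNMILL}$: for every stoup $S$, every (untagged) context $\Gamma$ and every formula $A$, there is a bijective correspondence between the set of derivations of $S \mid \Gamma \vdash A$ in the unfocused calculus quotiented by the congruence $\circeq$ and the set of derivations of the untagged sequent $S \mid \Gamma \vdash_{\mathsf{RI}} A$ in the focused calculus.
   Context: Fix a set $\mathsf{At}$ of atoms. Formulae are generated by $A, B ::= X \mid \mathsf{I} \mid A \otimes B \mid A \multimap B$ with $X \in \mathsf{At}$. A stoup $S$ is either empty (${-}$) or a single formula; a context $\Gamma$ is a finite ordered list of formulae. **Unfocused calculus.** Sequents are triples $S \mid \Gamma \vdash A$. Derivations are inductively generated by (premises $\Longrightarrow$ conclusion): - $\mathsf{ax}_A$: $\Longrightarrow A \mid \ \vdash A$ (any formula $A$); - $\mathsf{pass}$: $A \mid \Gamma \vdash C \Longrightarrow {-} \mid A, \Gamma \vdash C$; - ${\multimap}\mathsf{L}$: ${-} \mid \Gamma \vdash A$ and $B \mid \Delta \vdash C \Longrightarrow A \multimap B \mid \Gamma, \Delta \vdash C$; - ${\multimap}\mathsf{R}$: $S \mid \Gamma, A \vdash B \Longrightarrow S \mid \Gamma \vdash A \multimap B$; - $\mathsf{IL}$: ${-} \mid \Gamma \vdash C \Longrightarrow \mathsf{I} \mid \Gamma \vdash C$; - $\otimes\mathsf{L}$: $A \mid B, \Gamma \vdash C \Longrightarrow A \otimes B \mid \Gamma \vdash C$; - $\mathsf{IR}$: $\Longrightarrow {-} \mid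 \ \vdash \mathsf{I}$; - $\otimes\mathsf{R}$: $S \mid \Gamma \vdash A$ and ${-} \mid \Delta \vdash B \Longrightarrow S \mid \Gamma, \Delta \vdash A \otimes B$. **The congruence $\circeq$** is the smallest family of equivalence relations on derivations of the same sequent that is compatible with all rules and contains (for all well-typed $f,g,h$) $\mathsf{ax}_{\mathsf{I}} \circeq \mathsf{IL}(\mathsf{IR})$; $\mathsf{ax}_{A \otimes B} \circeq \otimes\mathsf{L}(\otimes\mathsf{R}(\mathsf{ax}_A, \mathsf{pass}\,\mathsf{ax}_B))$; $\mathsf{ax}_{A \multimap B} \circeq {\multimap}\mathsf{R}({\multimap}\mathsf{L}(\mathsf{pass}\,\mathsf{ax}_A, \mathsf{ax}_B))$; $\otimes\mathsf{R}(\mathsf{pass} f, g) \circeq \mathsf{pass}(\otimes\mathsf{R}(f,g))$; $\otimes\mathsf{R}(\mathsf{IL} f, g) \circeq \mathsf{IL}(\otimes\mathsf{R}(f,g))$; $\otimes\mathsf{R}(\otimes\mathsf{L} f, g) \circeq \otimes\mathsf{L}(\otimes\mathsf{R}(f,g))$; $\otimes\mathsf{R}({\multimap}\mathsf{L}(f,g), h) \circeq {\multimap}\mathsf{L}(f, \otimes\mathsf{R}(g,h))$; $\mathsf{pass}({\multimap}\mathsf{R} f) \circeq {\multimap}\mathsf{R}(\mathsf{pass} f)$; $\mathsf{IL}({\multimap}\mathsf{R} f) \circeq {\multimap}\mathsf{R}(\mathsf{IL} f)$; $\otimes\mathsf{L}({\multimap}\mathsf{R} f) \circeq {\multimap}\mathsf{R}(\otimes\mathsf{L}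 f)$; ${\multimap}\mathsf{L}(f, {\multimap}\mathsf{R} g) \circeq {\multimap}\mathsf{R}({\multimap}\mathsf{L}(f,g))$. **Focused calculus with tags.** Focused sequents have the form $S \mid \Gamma \vdash^x_{ph} C$ with phase $ph \in \{\mathsf{RI}, \mathsf{LI}, \mathsf{P}, \mathsf{F}\}$ and $x$ either blank (untagged sequent, written $\vdash_{ph}$) or $\bullet$ (tagged sequent). In a tagged sequent each context formula is either untagged ($A$) or tagged ($A^\bullet$), and all untagged formulae precede all tagged ones; in an untagged sequent all context formulae are untagged. For $x$ blank, $A^x$ means $A$. $\Gamma^\circ$ denotes $\Gamma$ with all tags removed. $P$ ranges over positive formulae (formulae not of the form $A \multimap B$); $T$ ranges over negative stoups (stoups that are neither $\mathsf{I}$ nor of the form $A \otimes B$; $T$ may be empty); $X$ ranges over atoms. In $\mathsf{LI}$, $\mathsf{P}$ and $\mathsf{F}$ phases the succedent is always positive, and in $\mathsf{P}$ and $\mathsf{F}$ phases the stoup is always negative. Rules (with $x$ arbitrary where written): - ${\multimap}\mathsf{R}$: $S \mid \Gamma, A^x \vdash^x_{\mathsf{RI}} B \Longrightarrow S \mid \Gamma \vdash^x_{\mathsf{RI}} A \multimap B$; - $\mathsf{LI2RI}$: $S \mid \Gamma \vdash^x_{\mathsf{LI}} P \Longrightarrow S \mid \Gamma \vdash^x_{\mathsf{RI}} P$; - $\mathsf{IL}$: ${-} \mid \Gamma \vdash_{\mathsf{LI}} P \Longrightarrow \mathsf{I} \mid \Gamma \vdash_{\mathsf{LI}} P$ (untagged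 only); - $\otimes\mathsf{L}$: $A \mid B, \Gamma \vdash_{\mathsf{LI}} P \Longrightarrow A \otimes B \mid \Gamma \vdash_{\mathsf{LI}} P$ (untagged only); - $\mathsf{P2LI}$: $T \mid \Gamma \vdash^x_{\mathsf{P}} P \Longrightarrow T \mid \Gamma \vdash^x_{\mathsf{LI}} P$; - $\mathsf{pass}$: $A \mid \Gamma^\circ \vdash_{\mathsf{LI}} P \Longrightarrow {-} \mid A^x, \Gamma \vdash^x_{\mathsf{P}} P$; - $\mathsf{F2P}$: $T \mid \Gamma \vdash^x_{\mathsf{F}} P \Longrightarrow T \mid \Gamma \vdash^x_{\mathsf{P}} P$; - $\mathsf{ax}$: $\Longrightarrow X \mid \ \vdash^x_{\mathsf{F}} X$ (atoms only); - $\mathsf{IR}$: $\Longrightarrow {-} \mid \ \vdash^x_{\mathsf{F}} \mathsf{I}$; - $\otimes\mathsf{R}$: $T \mid \Gamma^\circ \vdash^\bullet_{\mathsf{RI}} A$ and ${-} \mid \Delta^\circ \vdash_{\mathsf{RI}} B \Longrightarrow T \mid \Gamma, \Delta \vdash^x_{\mathsf{F}} A \otimes B$; - ${\multimap}\mathsf{L}$: ${-} \mid \Gamma^\circ \vdash_{\mathsf{RI}} A$ and $B \mid \Delta^\circ \vdash_{\mathsf{LI}} P \Longrightarrow A \multimap B \mid \Gamma, \Delta \vdash^x_{\mathsf{F}} P$, with the side condition that if $x = \bullet$ then at least one formula in $\Gamma$ is tagged. *)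

theory Defs
  imports Main
begin

section \<open>Formulae, stoups and contexts\<close>

datatype 'a fma =
    At 'a
  | Unit  ("\<I>")
  | Tensor "'a fma" "'a fma"  (infixr "\<otimes>" 75)
  | Lolli "'a fma" "'a fma"  (infixr "-\<circ>" 74)

text \<open>The stoup \<open>None\<close> is the empty one.\<close>

type_synonym 'a stoup = "'a fma option"
type_synonym 'a ctx = "'a fma list"

section \<open>The unfocused sequent calculus\<close>

text \<open>
  Derivations are trees of rule names, and \<open>derives S \<Gamma> A f\<close> says that \<open>f\<close> is a derivation
  of the sequent with stoup \<open>S\<close>, context \<open>\<Gamma>\<close> and succedent \<open>A\<close>. The conclusion of a rule other
  than \<open>ax\<close> and \<open>IR\<close> is a function of the conclusions of its premises, so once the leaves \<open>Ax\<close>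
  carry their formula a tree determines the sequent at each of its nodes (\<open>derives_unique\<close>)
  and no further annotation is needed.
\<close>

datatype 'a deriv =
    Ax "'a fma"
  | Pass "'a deriv"
  | LolliL "'a deriv" "'a deriv"
  | LolliR "'a deriv"
  | UnitL "'a deriv"
  | TensorL "'a deriv"
  | UnitR
  | TensorR "'a deriv" "'a deriv"

inductive derives :: "'a stoup \<Rightarrow> 'a ctx \<Rightarrow> 'a fma \<Rightarrow> 'a deriv \<Rightarrow> bool" where
  ax: "derives (Some A) [] A (Ax A)"
| pass: "derives (Some A) \<Gamma> C f \<Longrightarrow> derives None (A # \<Gamma>) C (Pass f)"
| lolliL: "\<lbrakk>derives None \<Gamma> A f; derives (Some B) \<Delta> C g\<rbrakk>
    \<Longrightarrow> derives (Some (A -\<circ> B)) (\<Gamma> @ \<Delta>) C (LolliL f g)"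
| lolliR: "derives S (\<Gamma> @ [A]) B f \<Longrightarrow> derives S \<Gamma> (A -\<circ> B) (LolliR f)"
| unitL: "derives None \<Gamma> C f \<Longrightarrow> derives (Some \<I>) \<Gamma> C (UnitL f)"
| tensorL: "derives (Some A) (B # \<Gamma>) C f \<Longrightarrow> derives (Some (A \<otimes> B)) \<Gamma> C (TensorL f)"
| unitR: "derives None [] \<I> UnitR"
| tensorR: "\<lbrakk>derives S \<Gamma> A f; derives None \<Delta> B g\<rbrakk>
    \<Longrightarrow> derives S (\<Gamma> @ \<Delta>) (A \<otimes> B) (TensorR f g)"

definition derivations :: "'a stoup \<Rightarrow> 'a ctx \<Rightarrow> 'a fma \<Rightarrow> 'a deriv set" where
  "derivations S \<Gamma> A = {f. derives S \<Gamma> A f}"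

inductive deriv_cong ::
  "'a stoup \<Rightarrow> 'a ctx \<Rightarrow> 'a fma \<Rightarrow> 'a deriv \<Rightarrow> 'a deriv \<Rightarrow> bool" where
  refl: "derives S \<Gamma> A f \<Longrightarrow> deriv_cong S \<Gamma> A f f"
| sym: "deriv_cong S \<Gamma> A f g \<Longrightarrow> deriv_cong S \<Gamma> A g f"
| trans: "\<lbrakk>deriv_cong S \<Gamma> A f g; deriv_cong S \<Gamma> A g h\<rbrakk> \<Longrightarrow> deriv_cong S \<Gamma> A f h"
  \<comment> \<open>compatibility with the rules\<close>
| pass: "deriv_cong (Some A) \<Gamma> C f f'
    \<Longrightarrow> deriv_cong None (A # \<Gamma>) C (Pass f) (Pass f')"
| lolliL: "\<lbrakk>deriv_cong None \<Gamma> A f f'; deriv_cong (Some B) \<Delta> C g g'\<rbrakk>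
    \<Longrightarrow> deriv_cong (Some (A -\<circ> B)) (\<Gamma> @ \<Delta>) C (LolliL f g) (LolliL f' g')"
| lolliR: "deriv_cong S (\<Gamma> @ [A]) B f f'
    \<Longrightarrow> deriv_cong S \<Gamma> (A -\<circ> B) (LolliR f) (LolliR f')"
| unitL: "deriv_cong None \<Gamma> C f f'
    \<Longrightarrow> deriv_cong (Some \<I>) \<Gamma> C (UnitL f) (UnitL f')"
| tensorL: "deriv_cong (Some A) (B # \<Gamma>) C f f'
    \<Longrightarrow> deriv_cong (Some (A \<otimes> B)) \<Gamma> C (TensorL f) (TensorL f')"
| tensorR: "\<lbrakk>deriv_cong S \<Gamma> A f f'; deriv_cong None \<Delta> B g g'\<rbrakk>
    \<Longrightarrow> deriv_cong S (\<Gamma> @ \<Delta>) (A \<otimes> B) (TensorR f g) (TensorR f' g')"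
  \<comment> \<open>\<open>\<eta>\<close>-conversions\<close>
| ax_unit: "deriv_cong (Some \<I>) [] \<I> (Ax \<I>) (UnitL UnitR)"
| ax_tensor: "deriv_cong (Some (A \<otimes> B)) [] (A \<otimes> B)
    (Ax (A \<otimes> B)) (TensorL (TensorR (Ax A) (Pass (Ax B))))"
| ax_lolli: "deriv_cong (Some (A -\<circ> B)) [] (A -\<circ> B)
    (Ax (A -\<circ> B)) (LolliR (LolliL (Pass (Ax A)) (Ax B)))"
  \<comment> \<open>permutative conversions\<close>
| tensorR_pass: "\<lbrakk>derives (Some A') \<Gamma> A f; derives None \<Delta> B g\<rbrakk>
    \<Longrightarrow> deriv_cong None (A' # \<Gamma> @ \<Delta>) (A \<otimes> B)
          (TensorR (Pass f) g) (Pass (TensorR f g))"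
| tensorR_unitL: "\<lbrakk>derives None \<Gamma> A f; derives None \<Delta> B g\<rbrakk>
    \<Longrightarrow> deriv_cong (Some \<I>) (\<Gamma> @ \<Delta>) (A \<otimes> B)
          (TensorR (UnitL f) g) (UnitL (TensorR f g))"
| tensorR_tensorL: "\<lbrakk>derives (Some A') (B' # \<Gamma>) A f; derives None \<Delta> B g\<rbrakk>
    \<Longrightarrow> deriv_cong (Some (A' \<otimes> B')) (\<Gamma> @ \<Delta>) (A \<otimes> B)
          (TensorR (TensorL f) g) (TensorL (TensorR f g))"
| tensorR_lolliL: "\<lbrakk>derives None \<Gamma> A' f; derives (Some B') \<Delta> A g; derives None \<Lambda> B h\<rbrakk>
    \<Longrightarrow> deriv_cong (Some (A' -\<circ> B')) (\<Gamma> @ \<Delta> @ \<Lambda>) (A \<otimes> B)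
          (TensorR (LolliL f g) h) (LolliL f (TensorR g h))"
| pass_lolliR: "derives (Some A') (\<Gamma> @ [A]) B f
    \<Longrightarrow> deriv_cong None (A' # \<Gamma>) (A -\<circ> B)
          (Pass (LolliR f)) (LolliR (Pass f))"
| unitL_lolliR: "derives None (\<Gamma> @ [A]) B f
    \<Longrightarrow> deriv_cong (Some \<I>) \<Gamma> (A -\<circ> B)
          (UnitL (LolliR f)) (LolliR (UnitL f))"
| tensorL_lolliR: "derives (Some A') (B' # \<Gamma> @ [A]) B f
    \<Longrightarrow> deriv_cong (Some (A' \<otimes> B')) \<Gamma> (A -\<circ> B)
          (TensorL (LolliR f)) (LolliR (TensorL f))"
| lolliL_lolliR: "\<lbrakk>derives None \<Gamma> A' f; derives (Some B') (\<Delta> @ [A]) B g\<rbrakk>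
    \<Longrightarrow> deriv_cong (Some (A' -\<circ> B')) (\<Gamma> @ \<Delta>) (A -\<circ> B)
          (LolliL f (LolliR g)) (LolliR (LolliL f g))"

definition deriv_cong_rel :: "'a stoup \<Rightarrow> 'a ctx \<Rightarrow> 'a fma \<Rightarrow> 'a deriv rel" where
  "deriv_cong_rel S \<Gamma> A = {(f, g). deriv_cong S \<Gamma> A f g}"

section \<open>The focused sequent calculus with tags\<close>

text \<open>
  A tag is a Boolean: \<open>True\<close> stands for the bullet and \<open>False\<close> for blank. This is used both for
  the tag \<open>x\<close> of a sequent and for the tags of the formulae in its context, so the formula
  written \<open>A\<close> superscript \<open>x\<close> on paper is the pair \<open>(A, x)\<close>.
\<close>

type_synonym tag = bool
type_synonym 'a tctx = "('a fma \<times> tag) list"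

definition untagged :: "'a ctx \<Rightarrow> 'a tctx" where
  "untagged \<Gamma> = map (\<lambda>A. (A, False)) \<Gamma>"

definition tagged :: "'a ctx \<Rightarrow> 'a tctx" where
  "tagged \<Gamma> = map (\<lambda>A. (A, True)) \<Gamma>"

text \<open>The operation written as the superscript circle on paper.\<close>

definition erase :: "'a tctx \<Rightarrow> 'a tctx" where
  "erase \<Gamma> = untagged (map fst \<Gamma>)"

text \<open>The contexts allowed in a sequent with tag \<open>x\<close>.\<close>

definition wf_tctx :: "tag \<Rightarrow> 'a tctx \<Rightarrow> bool" where
  "wf_tctx x \<Gamma> \<longleftrightarrow>
     (if x then \<exists>\<Gamma>\<^sub>1 \<Gamma>\<^sub>2. \<Gamma> = untagged \<Gamma>\<^sub>1 @ tagged \<Gamma>\<^sub>2 else \<exists>\<Gamma>\<^sub>1. \<Gamma> = untagged \<Gamma>\<^sub>1)"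

definition pos :: "'a fma \<Rightarrow> bool" where
  "pos A \<longleftrightarrow> (\<nexists>B C. A = B -\<circ> C)"

definition neg_stoup :: "'a stoup \<Rightarrow> bool" where
  "neg_stoup S \<longleftrightarrow> S \<noteq> Some \<I> \<and> (\<nexists>A B. S = Some (A \<otimes> B))"

datatype phase = Ph_RI | Ph_LI | Ph_P | Ph_F

text \<open>
  The parameters of a rule instance that cannot be recovered from the conclusions of its
  premises are stored in the tree: the tag of the conclusion and, where the premises only see
  the erased context, the original tagged one. A tree again determines the sequent at each of
  its nodes (\<open>fderives_unique\<close>).
\<close>

datatype 'a fderiv =
    FLolliR "'a fderiv"
  | LI2RI "'a fderiv"
  | FUnitL "'a fderiv"
  | FTensorL "'a fderiv"
  | P2LI "'a fderiv"
  | FPass tag "'a tctx" "'a fderiv"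
  | F2P "'a fderiv"
  | FAx tag 'a
  | FUnitR tag
  | FTensorR tag "'a tctx" "'a tctx" "'a fderiv" "'a fderiv"
  | FLolliL tag "'a tctx" "'a tctx" "'a fderiv" "'a fderiv"

text \<open>
  The conditions \<open>wf_tctx\<close>, \<open>pos\<close> and \<open>neg_stoup\<close> express that the conclusion of a rule has to be
  a sequent of the calculus. They are omitted where they follow from the premises
  (\<open>fderives_wf\<close>).
\<close>

inductive fderives ::
  "phase \<Rightarrow> tag \<Rightarrow> 'a stoup \<Rightarrow> 'a tctx \<Rightarrow> 'a fma \<Rightarrow> 'a fderiv \<Rightarrow> bool" where
  lolliR: "fderives Ph_RI x S (\<Gamma> @ [(A, x)]) B f
    \<Longrightarrow> fderives Ph_RI x S \<Gamma> (A -\<circ> B) (FLolliR f)"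
| li2ri: "\<lbrakk>pos C; fderives Ph_LI x S \<Gamma> C f\<rbrakk> \<Longrightarrow> fderives Ph_RI x S \<Gamma> C (LI2RI f)"
| unitL: "\<lbrakk>pos C; fderives Ph_LI False None \<Gamma> C f\<rbrakk>
    \<Longrightarrow> fderives Ph_LI False (Some \<I>) \<Gamma> C (FUnitL f)"
| tensorL: "\<lbrakk>pos C; fderives Ph_LI False (Some A) ((B, False) # \<Gamma>) C f\<rbrakk>
    \<Longrightarrow> fderives Ph_LI False (Some (A \<otimes> B)) \<Gamma> C (FTensorL f)"
| p2li: "\<lbrakk>neg_stoup T; pos C; fderives Ph_P x T \<Gamma> C f\<rbrakk> \<Longrightarrow> fderives Ph_LI x T \<Gamma> C (P2LI f)"
| pass: "\<lbrakk>wf_tctx x ((A, x) # \<Gamma>); pos C; fderives Ph_LI False (Some A) (erase \<Gamma>) C f\<rbrakk>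
    \<Longrightarrow> fderives Ph_P x None ((A, x) # \<Gamma>) C (FPass x \<Gamma> f)"
| f2p: "\<lbrakk>neg_stoup T; pos C; fderives Ph_F x T \<Gamma> C f\<rbrakk> \<Longrightarrow> fderives Ph_P x T \<Gamma> C (F2P f)"
| ax: "fderives Ph_F x (Some (At X)) [] (At X) (FAx x X)"
| unitR: "fderives Ph_F x None [] \<I> (FUnitR x)"
| tensorR: "\<lbrakk>wf_tctx x (\<Gamma> @ \<Delta>); neg_stoup T;
      fderives Ph_RI True T (erase \<Gamma>) A f; fderives Ph_RI False None (erase \<Delta>) B g\<rbrakk>
    \<Longrightarrow> fderives Ph_F x T (\<Gamma> @ \<Delta>) (A \<otimes> B) (FTensorR x \<Gamma> \<Delta> f g)"
| lolliL: "\<lbrakk>wf_tctx x (\<Gamma> @ \<Delta>); pos C; x \<longrightarrow> (\<exists>D. (D, True) \<in> set \<Gamma>);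
      fderives Ph_RI False None (erase \<Gamma>) A f; fderives Ph_LI False (Some B) (erase \<Delta>) C g\<rbrakk>
    \<Longrightarrow> fderives Ph_F x (Some (A -\<circ> B)) (\<Gamma> @ \<Delta>) C (FLolliL x \<Gamma> \<Delta> f g)"

definition fderivations ::
  "phase \<Rightarrow> tag \<Rightarrow> 'a stoup \<Rightarrow> 'a tctx \<Rightarrow> 'a fma \<Rightarrow> 'a fderiv set" where
  "fderivations ph x S \<Gamma> C = {f. fderives ph x S \<Gamma> C f}"

section \<open>Adequacy of the encoding\<close>

inductive_cases derives_treeE:
  "derives S \<Gamma> A (Ax B)"
  "derives S \<Gamma> A (Pass f)"
  "derives S \<Gamma> A (LolliL f g)"
  "derives S \<Gamma> A (LolliR f)"
  "derives S \<Gamma> A (UnitL f)"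
  "derives S \<Gamma> A (TensorL f)"
  "derives S \<Gamma> A UnitR"
  "derives S \<Gamma> A (TensorR f g)"

lemma derives_unique:
  "\<lbrakk>derives S \<Gamma> A f; derives S' \<Gamma>' A' f\<rbrakk> \<Longrightarrow> S = S' \<and> \<Gamma> = \<Gamma>' \<and> A = A'"
  by (induction f arbitrary: S \<Gamma> A S' \<Gamma>' A') (elim derives_treeE, fastforce)+

lemma deriv_cong_derives:
  "deriv_cong S \<Gamma> A f g \<Longrightarrow> derives S \<Gamma> A f \<and> derives S \<Gamma> A g"
proof (induction rule: deriv_cong.induct)
  case (tensorR_lolliL \<Gamma> A' f B' \<Delta> A g \<Lambda> B h)
  have "derives (Some (A' -\<circ> B')) ((\<Gamma> @ \<Delta>) @ \<Lambda>) (A \<otimes> B) (TensorR (LolliL f g) h)"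
    using tensorR_lolliL by (intro derives.intros)
  then show ?case
    using tensorR_lolliL by (auto intro!: derives.intros)
next
  case (tensorR_pass A' \<Gamma> A f \<Delta> B g)
  have "derives None ((A' # \<Gamma>) @ \<Delta>) (A \<otimes> B) (TensorR (Pass f) g)"
    using tensorR_pass by (intro derives.intros)
  then show ?case
    using tensorR_pass by (auto intro!: derives.intros)
next
  case (tensorR_tensorL A' B' \<Gamma> A f \<Delta> B g)
  have "derives (Some A') ((B' # \<Gamma>) @ \<Delta>) (A \<otimes> B) (TensorR f g)"
    using tensorR_tensorL by (intro derives.intros)
  then show ?case
    using tensorR_tensorL by (auto intro!: derives.intros)
next
  case (ax_tensor A B)
  have "derives (Some A) ([] @ [B]) (A \<otimes> B) (TensorR (Ax A) (Pass (Ax B)))"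
    by (rule derives.tensorR) (auto intro: derives.intros)
  then show ?case by (auto intro!: derives.intros)
next
  case (ax_lolli A B)
  have "derives (Some (A -\<circ> B)) ([A] @ []) B (LolliL (Pass (Ax A)) (Ax B))"
    by (rule derives.lolliL) (auto intro: derives.intros)
  then show ?case by (auto intro: derives.ax derives.lolliR)
next
  case (pass_lolliR A' \<Gamma> A B f)
  then show ?case by (auto intro!: derives.intros)
next
  case (tensorL_lolliR A' B' \<Gamma> A B f)
  then show ?case by (auto intro!: derives.intros)
next
  case (lolliL_lolliR \<Gamma> A' f B' \<Delta> A B g)
  have "derives (Some (A' -\<circ> B')) (\<Gamma> @ \<Delta> @ [A]) B (LolliL f g)"
    using lolliL_lolliR by (intro derives.intros)
  then show ?case
    using lolliL_lolliR by (auto intro: derives.lolliR derives.lolliL)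
qed (auto intro: derives.intros)

lemma equiv_deriv_cong_rel:
  "equiv (derivations S \<Gamma> A) (deriv_cong_rel S \<Gamma> A)"
  unfolding equiv_def refl_on_def sym_def trans_def derivations_def deriv_cong_rel_def
  by (auto dest: deriv_cong_derives intro: deriv_cong.refl deriv_cong.sym deriv_cong.trans)

lemma wf_tctx_snocD:
  assumes "wf_tctx x (\<Gamma> @ [(A, x)])"
  shows "wf_tctx x \<Gamma>"
proof (cases x)
  case True
  with assms obtain \<Gamma>\<^sub>1 \<Gamma>\<^sub>2 where *: "\<Gamma> @ [(A, True)] = untagged \<Gamma>\<^sub>1 @ tagged \<Gamma>\<^sub>2"
    by (auto simp: wf_tctx_def)
  show ?thesis
  proof (cases \<Gamma>\<^sub>2 rule: rev_cases)
    case Nil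
    with * have "(A, True) \<in> set (untagged \<Gamma>\<^sub>1)"
      by (metis append_Nil2 in_set_conv_decomp list.map_disc_iff tagged_def)
    then show ?thesis by (auto simp: untagged_def)
  next
    case (snoc \<Delta> B)
    with * have "\<Gamma> = untagged \<Gamma>\<^sub>1 @ tagged \<Delta>"
      by (simp add: tagged_def flip: append_assoc)
    with True show ?thesis by (auto simp: wf_tctx_def)
  qed
next
  case False
  with assms obtain \<Gamma>\<^sub>1 where "\<Gamma> @ [(A, False)] = untagged \<Gamma>\<^sub>1"
    by (auto simp: wf_tctx_def)
  then have "\<Gamma> = untagged (butlast \<Gamma>\<^sub>1)"
    by (metis butlast_snoc map_butlast untagged_def)
  with False show ?thesis by (auto simp: wf_tctx_def)
qed

lemma fderives_wf:
  "fderives ph x S \<Gamma> C f \<Longrightarrow>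
    wf_tctx x \<Gamma> \<and> (ph \<noteq> Ph_RI \<longrightarrow> pos C) \<and> (ph \<in> {Ph_P, Ph_F} \<longrightarrow> neg_stoup S)"
proof (induction rule: fderives.induct)
  case (lolliR x S \<Gamma> A B f)
  then show ?case by (auto dest: wf_tctx_snocD)
qed (auto simp: wf_tctx_def untagged_def tagged_def pos_def neg_stoup_def Cons_eq_map_conv)

inductive_cases fderives_treeE:
  "fderives ph x S \<Gamma> C (FLolliR f)"
  "fderives ph x S \<Gamma> C (LI2RI f)"
  "fderives ph x S \<Gamma> C (FUnitL f)"
  "fderives ph x S \<Gamma> C (FTensorL f)"
  "fderives ph x S \<Gamma> C (P2LI f)"
  "fderives ph x S \<Gamma> C (FPass y \<Delta> f)"
  "fderives ph x S \<Gamma> C (F2P f)"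
  "fderives ph x S \<Gamma> C (FAx y X)"
  "fderives ph x S \<Gamma> C (FUnitR y)"
  "fderives ph x S \<Gamma> C (FTensorR y \<Delta> \<Lambda> f g)"
  "fderives ph x S \<Gamma> C (FLolliL y \<Delta> \<Lambda> f g)"

lemma fderives_unique:
  assumes "fderives ph x S \<Gamma> A f" "fderives ph' x' S' \<Gamma>' A' f"
  shows "ph = ph' \<and> x = x' \<and> S = S' \<and> \<Gamma> = \<Gamma>' \<and> A = A'"
  using assms
proof (induction arbitrary: ph' x' S' \<Gamma>' A' rule: fderives.induct)
  case lolliR
  from lolliR.prems show ?case by (rule fderives_treeE) (auto dest!: lolliR.IH)
next
  case li2ri
  from li2ri.prems show ?case by (rule fderives_treeE) (auto dest!: li2ri.IH)
next
  case unitL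
  from unitL.prems show ?case by (rule fderives_treeE) (auto dest!: unitL.IH)
next
  case tensorL
  from tensorL.prems show ?case by (rule fderives_treeE) (auto dest!: tensorL.IH)
next
  case p2li
  from p2li.prems show ?case by (rule fderives_treeE) (auto dest!: p2li.IH)
next
  case pass
  from pass.prems show ?case by (rule fderives_treeE) (auto dest!: pass.IH)
next
  case f2p
  from f2p.prems show ?case by (rule fderives_treeE) (auto dest!: f2p.IH)
next
  case tensorR
  from tensorR.prems show ?case by (rule fderives_treeE) (auto dest!: tensorR.IH)
next
  case lolliL
  from lolliL.prems show ?case by (rule fderives_treeE) (auto dest!: lolliL.IH)
qed (auto elim: fderives_treeE)

end

theory Submission
  imports Defs
begin

text \<open>
  Forgetting phases and tags embeds focused derivations into unfocused ones, and the image consists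
  of the trees satisfying a predicate \<open>nf\<close>. Of the tags only one number survives: in a tagged
  sequent it counts the formulae that were already in the context at the nearest \<open>\<otimes>R\<close> below, as
  opposed to those added since by \<open>\<multimap>R\<close>. There \<open>pass\<close> and \<open>\<multimap>L\<close> are allowed only if they
  cannot be permuted below that \<open>\<otimes>R\<close>. Reading the permutative conversions from left to right, and
  \<open>\<eta>\<close>-expanding all axioms, yields a function \<open>norm\<close> that selects a unique normal tree from each
  congruence class.
\<close>

section \<open>Normal derivations\<close>

text \<open>Trees store no contexts, so the lengths that \<open>nf\<close> and
  \<open>tensorR_nf\<close> compare are recomputed here. The truncated subtractions are exact on
  derivations.\<close>

primrec ctx_length :: "'a deriv \<Rightarrow> nat" where
  "ctx_length (Ax A) = 0"
| "ctx_length (Pass f) = Suc (ctx_length f)"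
| "ctx_length (LolliL f g) = ctx_length f + ctx_length g"
| "ctx_length (LolliR f) = ctx_length f - 1"
| "ctx_length (UnitL f) = ctx_length f"
| "ctx_length (TensorL f) = ctx_length f - 1"
| "ctx_length UnitR = 0"
| "ctx_length (TensorR f g) = ctx_length f + ctx_length g"

lemma ctx_length_derives: "derives S \<Gamma> A f \<Longrightarrow> ctx_length f = length \<Gamma>"
  by (induction rule: derives.induct) auto

primrec is_lolliR :: "'a deriv \<Rightarrow> bool" where
  "is_lolliR (Ax A) = False"
| "is_lolliR (Pass f) = False"
| "is_lolliR (LolliL f g) = False"
| "is_lolliR (LolliR f) = True"
| "is_lolliR (UnitL f) = False"
| "is_lolliR (TensorL f) = False"
| "is_lolliR UnitR = False"
| "is_lolliR (TensorR f g) = False"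

text \<open>
  The parameter is \<open>None\<close> for an untagged sequent and \<open>Some m\<close> for a tagged one whose first \<open>m\<close>
  context formulae are untagged. The phase \<open>LI\<close> corresponds to \<open>\<not> is_lolliR f\<close>; the positivity
  conditions on succedents and stoups then hold automatically.
\<close>

primrec nf :: "nat option \<Rightarrow> 'a deriv \<Rightarrow> bool" where
  "nf x (Ax A) \<longleftrightarrow> (\<exists>X. A = At X)"
| "nf x (Pass f) \<longleftrightarrow> (x = None \<or> x = Some 0) \<and> \<not> is_lolliR f \<and> nf None f"
| "nf x (LolliL f g) \<longleftrightarrow>
    (\<forall>m. x = Some m \<longrightarrow> m < ctx_length f) \<and> nf None f \<and> \<not> is_lolliR g \<and> nf None g"
| "nf x (LolliR f) \<longleftrightarrow> nf x f"
| "nf x (UnitL f) \<longleftrightarrow> x = None \<and> \<not> is_lolliR f \<and> nf None f"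
| "nf x (TensorL f) \<longleftrightarrow> x = None \<and> \<not> is_lolliR f \<and> nf None f"
| "nf x UnitR \<longleftrightarrow> True"
| "nf x (TensorR f g) \<longleftrightarrow> nf (Some (ctx_length f)) f \<and> nf None g"

text \<open>Normal axioms are atomic and normal left rules have a premise not ending in
  \<open>LolliR\<close>, so only \<open>LolliR\<close> at the root can yield an implication.\<close>

lemma nf_pos: "\<lbrakk>derives S \<Gamma> A f; nf x f; \<not> is_lolliR f\<rbrakk> \<Longrightarrow> pos A"
  by (induction arbitrary: x rule: derives.induct) (auto simp: pos_def)

text \<open>A parameter \<open>Some m\<close> excludes \<open>UnitL\<close> and
  \<open>TensorL\<close>, and right rules keep the stoup. This supplies the stoup condition of the
  focused \<otimes>R.\<close>

lemma nf_neg_stoup: "\<lbrakk>derives S \<Gamma> A f; nf (Some m) f\<rbrakk> \<Longrightarrow> neg_stoup S"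
  by (induction arbitrary: m rule: derives.induct) (auto simp: neg_stoup_def)

section \<open>Normalization\<close>

text \<open>
  What \<open>pass\<close>, \<open>IL\<close>, \<open>\<otimes>L\<close> and \<open>\<multimap>L\<close> (with its first premise fixed) have in common: as unary
  rules they replace stoup \<open>S\<close> and context prefix \<open>\<Theta>\<close> by \<open>S'\<close> and \<open>\<Theta>'\<close>, and they permute
  with both right rules.
\<close>

definition permutable ::
  "('a deriv \<Rightarrow> 'a deriv) \<Rightarrow> 'a stoup \<Rightarrow> 'a ctx \<Rightarrow> 'a stoup \<Rightarrow> 'a ctx \<Rightarrow> bool" where
  "permutable c S \<Theta> S' \<Theta>' \<longleftrightarrow>
    (\<forall>\<Gamma> A f f'. deriv_cong S (\<Theta> @ \<Gamma>) A f f' \<longrightarrow> deriv_cong S' (\<Theta>' @ \<Gamma>) A (c f) (c f')) \<and>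
    (\<forall>\<Gamma> A B f. derives S (\<Theta> @ \<Gamma> @ [A]) B f \<longrightarrow>
      deriv_cong S' (\<Theta>' @ \<Gamma>) (A -\<circ> B) (c (LolliR f)) (LolliR (c f))) \<and>
    (\<forall>\<Gamma> \<Delta> A B f g. derives S (\<Theta> @ \<Gamma>) A f \<longrightarrow> derives None \<Delta> B g \<longrightarrow>
      deriv_cong S' (\<Theta>' @ \<Gamma> @ \<Delta>) (A \<otimes> B) (TensorR (c f) g) (c (TensorR f g)))"

lemma permutable_cong:
  "\<lbrakk>permutable c S \<Theta> S' \<Theta>'; deriv_cong S (\<Theta> @ \<Gamma>) A f f'\<rbrakk>
    \<Longrightarrow> deriv_cong S' (\<Theta>' @ \<Gamma>) A (c f) (c f')"
  unfolding permutable_def by blast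

lemma permutable_lolliR:
  "\<lbrakk>permutable c S \<Theta> S' \<Theta>'; derives S (\<Theta> @ \<Gamma> @ [A]) B f\<rbrakk>
    \<Longrightarrow> deriv_cong S' (\<Theta>' @ \<Gamma>) (A -\<circ> B) (c (LolliR f)) (LolliR (c f))"
  unfolding permutable_def by blast

lemma permutable_tensorR:
  "\<lbrakk>permutable c S \<Theta> S' \<Theta>'; derives S (\<Theta> @ \<Gamma>) A f; derives None \<Delta> B g\<rbrakk>
    \<Longrightarrow> deriv_cong S' (\<Theta>' @ \<Gamma> @ \<Delta>) (A \<otimes> B) (TensorR (c f) g) (c (TensorR f g))"
  unfolding permutable_def by blast

lemma permutable_Pass: "permutable Pass (Some A) [] None [A]"
  unfolding permutable_def by (auto intro: deriv_cong.intros)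

lemma permutable_UnitL: "permutable UnitL None [] (Some \<I>) []"
  unfolding permutable_def by (auto intro: deriv_cong.intros)

lemma permutable_TensorL: "permutable TensorL (Some A) [B] (Some (A \<otimes> B)) []"
  unfolding permutable_def by (auto intro: deriv_cong.intros)

lemma permutable_LolliL:
  "derives None \<Delta> A h \<Longrightarrow> permutable (LolliL h) (Some B) [] (Some (A -\<circ> B)) \<Delta>"
  unfolding permutable_def by (auto intro: deriv_cong.intros)

section \<open>Left rules above blocks of \<multimap>R\<close>

text \<open>The normalizing version of a left rule \<open>c\<close>: it is inserted above the block
  of \<open>LolliR\<close> that ends the tree, as the order of the phases RI and LI demands.\<close>

primrec under_lolliR :: "('a deriv \<Rightarrow> 'a deriv) \<Rightarrow> 'a deriv \<Rightarrow> 'a deriv" where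
  "under_lolliR c (Ax A) = c (Ax A)"
| "under_lolliR c (Pass f) = c (Pass f)"
| "under_lolliR c (LolliL f g) = c (LolliL f g)"
| "under_lolliR c (LolliR f) = LolliR (under_lolliR c f)"
| "under_lolliR c (UnitL f) = c (UnitL f)"
| "under_lolliR c (TensorL f) = c (TensorL f)"
| "under_lolliR c UnitR = c UnitR"
| "under_lolliR c (TensorR f g) = c (TensorR f g)"

lemma under_lolliR_eq: "\<not> is_lolliR f \<Longrightarrow> under_lolliR c f = c f"
  by (cases f) auto

lemma nf_under_lolliR:
  assumes "nf None f" "\<And>h. \<lbrakk>nf None h; \<not> is_lolliR h\<rbrakk> \<Longrightarrow> nf None (c h)"
  shows "nf None (under_lolliR c f)"
  using assms(1) by (induction f) (auto intro!: assms(2))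

lemma deriv_cong_under_lolliR:
  assumes c: "permutable c S \<Theta> S' \<Theta>'" and "derives S (\<Theta> @ \<Gamma>) A f"
  shows "deriv_cong S' (\<Theta>' @ \<Gamma>) A (c f) (under_lolliR c f)"
  using assms(2)
proof (induction f arbitrary: \<Gamma> A rule: deriv.induct)
  case (LolliR f)
  then obtain B C where A: "A = B -\<circ> C" and f: "derives S (\<Theta> @ \<Gamma> @ [B]) C f"
    by (auto elim: derives_treeE)
  from LolliR.IH[OF f] have "deriv_cong S' ((\<Theta>' @ \<Gamma>) @ [B]) C (c f) (under_lolliR c f)"
    by simp
  with permutable_lolliR[OF c f] show ?case
    unfolding A by (auto intro: deriv_cong.trans[OF _ deriv_cong.lolliR])
qed (auto intro: permutable_cong[OF c] deriv_cong.refl)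

text \<open>The list \<open>\<Gamma>'\<close> keeps track of the formulae discharged by a block of
  \<open>LolliR\<close>; the last one is discharged first, hence \<open>foldr\<close>.\<close>

lemma derives_funpow_lolliR:
  "derives S (\<Gamma> @ \<Gamma>') A f \<Longrightarrow> derives S \<Gamma> (foldr (-\<circ>) \<Gamma>' A) ((LolliR ^^ length \<Gamma>') f)"
  by (induction \<Gamma>' arbitrary: \<Gamma>) (auto intro: derives.lolliR)

lemma permutable_funpow_lolliR:
  assumes c: "permutable c S \<Theta> S' \<Theta>'" and "derives S (\<Theta> @ \<Gamma> @ \<Gamma>') A f"
  shows "deriv_cong S' (\<Theta>' @ \<Gamma>) (foldr (-\<circ>) \<Gamma>' A)
    ((LolliR ^^ length \<Gamma>') (c f)) (c ((LolliR ^^ length \<Gamma>') f))"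
  using assms(2)
proof (induction \<Gamma>' arbitrary: \<Gamma>)
  case Nil
  then show ?case by (auto intro: permutable_cong[OF c] deriv_cong.refl)
next
  case (Cons B \<Gamma>')
  let ?L = "LolliR ^^ length \<Gamma>'"
  have "deriv_cong S' ((\<Theta>' @ \<Gamma>) @ [B]) (foldr (-\<circ>) \<Gamma>' A) (?L (c f)) (c (?L f))"
    using Cons.IH[of "\<Gamma> @ [B]"] Cons.prems by simp
  moreover have "derives S (\<Theta> @ \<Gamma> @ [B]) (foldr (-\<circ>) \<Gamma>' A) (?L f)"
    using derives_funpow_lolliR[of S "\<Theta> @ \<Gamma> @ [B]"] Cons.prems by simp
  ultimately show ?case
    by (auto intro: deriv_cong.trans[OF deriv_cong.lolliR deriv_cong.sym]
        dest: permutable_lolliR[OF c])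
qed

section \<open>Normalizing \<otimes>R\<close>

text \<open>
  The first argument counts the \<open>\<multimap>R\<close> rules already traversed. A \<open>pass\<close> or \<open>\<multimap>L\<close> that acts
  on one of the formulae they moved blocks the permutation.
\<close>

primrec tensorR_nf :: "nat \<Rightarrow> 'a deriv \<Rightarrow> 'a deriv \<Rightarrow> 'a deriv" where
  "tensorR_nf k (Ax A) g = TensorR ((LolliR ^^ k) (Ax A)) g"
| "tensorR_nf k (Pass f) g =
    (if k \<le> ctx_length f then Pass (tensorR_nf k f g) else TensorR ((LolliR ^^ k) (Pass f)) g)"
| "tensorR_nf k (LolliL h f) g =
    (if k \<le> ctx_length f then LolliL h (tensorR_nf k f g)
     else TensorR ((LolliR ^^ k) (LolliL h f)) g)"
| "tensorR_nf k (LolliR f) g = tensorR_nf (Suc k) f g"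
| "tensorR_nf k (UnitL f) g = UnitL (tensorR_nf k f g)"
| "tensorR_nf k (TensorL f) g = TensorL (tensorR_nf k f g)"
| "tensorR_nf k UnitR g = TensorR ((LolliR ^^ k) UnitR) g"
| "tensorR_nf k (TensorR f f') g = TensorR ((LolliR ^^ k) (TensorR f f')) g"

lemma not_is_lolliR_tensorR_nf: "\<not> is_lolliR (tensorR_nf k f g)"
  by (induction f arbitrary: k) auto

lemma ctx_length_funpow_lolliR [simp]: "ctx_length ((LolliR ^^ k) f) = ctx_length f - k"
  by (induction k) auto

lemma nf_funpow_lolliR [simp]: "nf x ((LolliR ^^ k) f) = nf x f"
  by (induction k) auto

text \<open>The new left premise has a context of length \<open>length \<Gamma> - k\<close>.
  Stopping at \<open>Pass f\<close> means \<open>k > ctx_length f\<close>, so this length is 0;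
  stopping at \<open>LolliL h f\<close> makes it smaller than \<open>ctx_length h\<close>. These are
  the bounds in \<open>nf\<close>.\<close>

lemma nf_tensorR_nf:
  "\<lbrakk>derives S \<Gamma> A f; k \<le> length \<Gamma>; nf None f; nf None g\<rbrakk> \<Longrightarrow> nf None (tensorR_nf k f g)"
proof (induction arbitrary: k rule: derives.induct)
  case (pass A \<Gamma> C f)
  then show ?case by (auto simp: not_is_lolliR_tensorR_nf ctx_length_derives)
next
  case (lolliL \<Gamma> A f B \<Delta> C g)
  then show ?case by (auto simp: not_is_lolliR_tensorR_nf ctx_length_derives)
qed (auto simp: not_is_lolliR_tensorR_nf)

text \<open>Converse reading of the bounds in \<open>nf\<close>: with \<open>m\<close> old formulae
  and \<open>k\<close> moved ones, \<open>Pass\<close> forces \<open>m = 0\<close> and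
  \<open>LolliL\<close> uses more than \<open>m\<close> formulae, so \<open>k\<close> exceeds the
  context left and no permutation fires.\<close>

lemma tensorR_nf_blocked:
  "\<lbrakk>derives S \<Gamma> A f; nf (Some m) f; length \<Gamma> = m + k\<rbrakk>
    \<Longrightarrow> tensorR_nf k f g = TensorR ((LolliR ^^ k) f) g"
  by (induction arbitrary: k rule: derives.induct) (auto simp: funpow_swap1 ctx_length_derives)

text \<open>Traversing a \<open>LolliR\<close> raises \<open>k\<close> and the context length alike,
  so the bound survives down to \<open>c\<close>, which then moves to the root. The result never
  ends in \<open>LolliR\<close>, so there \<open>under_lolliR c\<close> is just
  \<open>c\<close>.\<close>

lemma tensorR_nf_under_lolliR:
  assumes "\<And>k f. k \<le> ctx_length f \<Longrightarrow> tensorR_nf k (c f) g = c (tensorR_nf k f g)"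
    and "derives S \<Gamma> A f" and "k \<le> length \<Gamma>"
  shows "tensorR_nf k (under_lolliR c f) g = under_lolliR c (tensorR_nf k f g)"
proof -
  have "tensorR_nf k (under_lolliR c f) g = c (tensorR_nf k f g)"
    using assms(2,3)
  proof (induction arbitrary: k rule: derives.induct)
  qed (auto simp: assms(1) ctx_length_derives)
  then show ?thesis by (simp add: under_lolliR_eq not_is_lolliR_tensorR_nf)
qed

text \<open>The inductive step for \<open>tensorR_nf\<close>: \<open>c\<close> is permuted out of
  the block of \<open>LolliR\<close>, then out of \<open>TensorR\<close>, and \<open>h\<close>
  replaces what remains.\<close>

lemma deriv_cong_TensorR_funpow_lolliR:
  assumes c: "permutable c S \<Theta> S' \<Theta>'"
    and f: "derives S (\<Theta> @ \<Gamma> @ \<Gamma>') A f" and g: "derives None \<Delta> B g"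
    and h: "deriv_cong S (\<Theta> @ \<Gamma> @ \<Delta>) (foldr (-\<circ>) \<Gamma>' A \<otimes> B)
      (TensorR ((LolliR ^^ length \<Gamma>') f) g) h"
  shows "deriv_cong S' (\<Theta>' @ \<Gamma> @ \<Delta>) (foldr (-\<circ>) \<Gamma>' A \<otimes> B)
    (TensorR ((LolliR ^^ length \<Gamma>') (c f)) g) (c h)"
proof -
  let ?L = "LolliR ^^ length \<Gamma>'"
  have "deriv_cong S' ((\<Theta>' @ \<Gamma>) @ \<Delta>) (foldr (-\<circ>) \<Gamma>' A \<otimes> B)
      (TensorR (?L (c f)) g) (TensorR (c (?L f)) g)"
    using permutable_funpow_lolliR[OF c f] g by (intro deriv_cong.tensorR deriv_cong.refl)
  moreover have "derives S (\<Theta> @ \<Gamma>) (foldr (-\<circ>) \<Gamma>' A) (?L f)"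
    using derives_funpow_lolliR[of S "\<Theta> @ \<Gamma>"] f by simp
  ultimately show ?thesis
    using permutable_tensorR[OF c _ g] permutable_cong[OF c h]
    by (metis append_assoc deriv_cong.trans)
qed

text \<open>Only the case \<open>\<Gamma>' = []\<close> is wanted. The general form lets the
  induction pass a \<open>LolliR\<close>, whose discharged formula joins
  \<open>\<Gamma>'\<close>.\<close>

lemma deriv_cong_tensorR_nf:
  assumes "derives S (\<Gamma> @ \<Gamma>') A f" and g: "derives None \<Delta> B g"
  shows "deriv_cong S (\<Gamma> @ \<Delta>) (foldr (-\<circ>) \<Gamma>' A \<otimes> B)
    (TensorR ((LolliR ^^ length \<Gamma>') f) g) (tensorR_nf (length \<Gamma>') f g)"
proof -
  \<comment> \<open>Covers every place where the recursion of \<open>tensorR_nf\<close> ends: both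
    sides are then the same tree.\<close>
  have stop: "deriv_cong S (\<Gamma> @ \<Delta>) (foldr (-\<circ>) \<Gamma>' A \<otimes> B)
      (TensorR ((LolliR ^^ length \<Gamma>') f) g) (TensorR ((LolliR ^^ length \<Gamma>') f) g)"
    if "derives S (\<Gamma> @ \<Gamma>') A f" for S \<Gamma> \<Gamma>' A f
    using that g by (intro deriv_cong.refl derives.tensorR derives_funpow_lolliR)
  show ?thesis
    using assms(1)
  proof (induction f arbitrary: S \<Gamma> \<Gamma>' A rule: deriv.induct)
    case (Ax C)
    then show ?case using stop by fastforce
  next
    case (Pass f)
    show ?case
    proof (cases "length \<Gamma>' \<le> ctx_length f")
      case True
      from Pass.prems obtain C \<Lambda> where *: "S = None" "\<Gamma> @ \<Gamma>' = C # \<Lambda>" "derives (Some C) \<Lambda> A f"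
        by (auto elim: derives_treeE)
      \<comment> \<open>By the bound, \<open>\<Gamma>'\<close> fits into \<open>\<Lambda>\<close>,
        so the passed formula \<open>C\<close> is not one of the moved ones.\<close>
      then have "\<Gamma> \<noteq> []" using True by (auto dest!: ctx_length_derives)
      then obtain \<Gamma>0 where \<Gamma>: "\<Gamma> = C # \<Gamma>0" and f: "derives (Some C) (\<Gamma>0 @ \<Gamma>') A f"
        using * by (cases \<Gamma>) auto
      show ?thesis
        using deriv_cong_TensorR_funpow_lolliR[OF permutable_Pass _ g, of C \<Gamma>0 \<Gamma>' A f]
          Pass.IH[OF f] f True * \<Gamma> by simp
    next
      case False
      then show ?thesis using stop[OF Pass.prems] by simp
    qed
  next
    case (LolliL h f)
    show ?case
    proof (cases "length \<Gamma>' \<le> ctx_length f")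
      case True
      from LolliL.prems obtain C D \<Lambda> \<Lambda>' where *: "S = Some (C -\<circ> D)" "\<Gamma> @ \<Gamma>' = \<Lambda> @ \<Lambda>'"
        and h: "derives None \<Lambda> C h" and "derives (Some D) \<Lambda>' A f"
        by (auto elim: derives_treeE)
      \<comment> \<open>By the bound, \<open>\<Gamma>'\<close> is a suffix of
        \<open>\<Lambda>'\<close>, so the first premise of \<open>LolliL\<close> uses no moved
        formula.\<close>
      moreover from this obtain \<Gamma>0 where "\<Gamma> = \<Lambda> @ \<Gamma>0" "\<Lambda>' = \<Gamma>0 @ \<Gamma>'"
        using True by (auto simp: append_eq_append_conv2 dest!: ctx_length_derives)
      ultimately have \<Gamma>: "\<Gamma> = \<Lambda> @ \<Gamma>0" and f: "derives (Some D) (\<Gamma>0 @ \<Gamma>') A f"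
        by auto
      show ?thesis
        using deriv_cong_TensorR_funpow_lolliR[OF permutable_LolliL[OF h] _ g, of D \<Gamma>0 \<Gamma>' A f]
          LolliL.IH(2)[OF f] f True * \<Gamma> by simp
    next
      case False
      then show ?thesis using stop[OF LolliL.prems] by simp
    qed
  next
    case (LolliR f)
    then obtain C D where A: "A = C -\<circ> D" and "derives S (\<Gamma> @ \<Gamma>' @ [C]) D f"
      by (auto elim: derives_treeE)
    from LolliR.IH[OF this(2)] show ?case by (simp add: A funpow_swap1)
  next
    case (UnitL f)
    then have S: "S = Some \<I>" and f: "derives None (\<Gamma> @ \<Gamma>') A f"
      by (auto elim: derives_treeE)
    show ?case
      using deriv_cong_TensorR_funpow_lolliR[OF permutable_UnitL _ g, of \<Gamma> \<Gamma>' A f]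
        UnitL.IH[OF f] f by (simp add: S)
  next
    case (TensorL f)
    then obtain C D where S: "S = Some (C \<otimes> D)" and "derives (Some C) (D # \<Gamma> @ \<Gamma>') A f"
      by (auto elim: derives_treeE)
    then have f: "derives (Some C) ((D # \<Gamma>) @ \<Gamma>') A f" by simp
    show ?case
      using deriv_cong_TensorR_funpow_lolliR[OF permutable_TensorL _ g, of C D \<Gamma> \<Gamma>' A f]
        TensorL.IH[OF f] f by (simp add: S)
  next
    case UnitR
    then show ?case using stop by fastforce
  next
    case (TensorR f f')
    then show ?case using stop[OF TensorR.prems] by simp
  qed
qed

section \<open>Expanded axioms and the normalization function\<close>

text \<open>The right-hand sides of the \<eta>-conversions with each rule replaced by its
  normalizing version, so that \<open>norm\<close> equates both sides of these conversions.\<close>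

primrec ax_nf :: "'a fma \<Rightarrow> 'a deriv" where
  "ax_nf (At X) = Ax (At X)"
| "ax_nf \<I> = UnitL UnitR"
| "ax_nf (A \<otimes> B) =
    under_lolliR TensorL (tensorR_nf 0 (ax_nf A) (under_lolliR Pass (ax_nf B)))"
| "ax_nf (A -\<circ> B) =
    LolliR (under_lolliR (LolliL (under_lolliR Pass (ax_nf A))) (ax_nf B))"

primrec norm :: "'a deriv \<Rightarrow> 'a deriv" where
  "norm (Ax A) = ax_nf A"
| "norm (Pass f) = under_lolliR Pass (norm f)"
| "norm (LolliL f g) = under_lolliR (LolliL (norm f)) (norm g)"
| "norm (LolliR f) = LolliR (norm f)"
| "norm (UnitL f) = under_lolliR UnitL (norm f)"
| "norm (TensorL f) = under_lolliR TensorL (norm f)"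
| "norm UnitR = UnitR"
| "norm (TensorR f g) = tensorR_nf 0 (norm f) (norm g)"

lemma deriv_cong_TensorR_tensorR_nf:
  assumes f: "deriv_cong S \<Gamma> A f f'" and g: "deriv_cong None \<Delta> B g g'"
  shows "deriv_cong S (\<Gamma> @ \<Delta>) (A \<otimes> B) (TensorR f g) (tensorR_nf 0 f' g')"
proof -
  have "deriv_cong S (\<Gamma> @ \<Delta>) (A \<otimes> B) (TensorR f' g') (tensorR_nf 0 f' g')"
    using deriv_cong_tensorR_nf[of S \<Gamma> "[]" A f' \<Delta> B g'] f g
    by (auto dest: deriv_cong_derives)
  with deriv_cong.tensorR[OF f g] show ?thesis by (rule deriv_cong.trans)
qed

lemma deriv_cong_permutable_under_lolliR:
  assumes c: "permutable c S \<Theta> S' \<Theta>'" and f: "deriv_cong S (\<Theta> @ \<Gamma>) A f f'"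
  shows "deriv_cong S' (\<Theta>' @ \<Gamma>) A (c f) (under_lolliR c f')"
  using permutable_cong[OF c f] deriv_cong_under_lolliR[OF c, of \<Gamma> A f'] deriv_cong_derives[OF f]
  by (blast intro: deriv_cong.trans)

lemmas deriv_cong_Pass_nf =
  deriv_cong_permutable_under_lolliR[OF permutable_Pass, simplified]

lemmas deriv_cong_UnitL_nf =
  deriv_cong_permutable_under_lolliR[OF permutable_UnitL, simplified]

lemmas deriv_cong_TensorL_nf =
  deriv_cong_permutable_under_lolliR[OF permutable_TensorL, simplified]

text \<open>\<open>permutable_LolliL\<close> keeps the first premise fixed, so compatibility first
  replaces both premises; then the rule moves above the \<open>LolliR\<close> block.\<close>

lemma deriv_cong_LolliL_nf:
  assumes f: "deriv_cong None \<Gamma> A f f'" and g: "deriv_cong (Some B) \<Delta> C g g'"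
  shows "deriv_cong (Some (A -\<circ> B)) (\<Gamma> @ \<Delta>) C (LolliL f g) (under_lolliR (LolliL f') g')"
proof -
  have "derives None \<Gamma> A f'" using deriv_cong_derives[OF f] by blast
  from deriv_cong_permutable_under_lolliR[OF permutable_LolliL[OF this], simplified,
      OF deriv_cong.refl]
  have "deriv_cong (Some (A -\<circ> B)) (\<Gamma> @ \<Delta>) C (LolliL f' g') (under_lolliR (LolliL f') g')"
    using deriv_cong_derives[OF g] by blast
  with deriv_cong.lolliL[OF f g] show ?thesis by (rule deriv_cong.trans)
qed

lemma deriv_cong_ax_nf: "deriv_cong (Some A) [] A (Ax A) (ax_nf A)"
proof (induction A)
  case (At X)
  show ?case by (simp add: deriv_cong.refl derives.ax)
next
  case Unit
  show ?case by (simp add: deriv_cong.ax_unit)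
next
  case (Tensor A B)
  have "deriv_cong (Some A) ([] @ [B]) (A \<otimes> B) (TensorR (Ax A) (Pass (Ax B)))
      (tensorR_nf 0 (ax_nf A) (under_lolliR Pass (ax_nf B)))"
    using Tensor by (intro deriv_cong_TensorR_tensorR_nf deriv_cong_Pass_nf)
  then show ?case
    by (auto intro: deriv_cong.trans[OF deriv_cong.ax_tensor] deriv_cong_TensorL_nf)
next
  case (Lolli A B)
  have "deriv_cong (Some (A -\<circ> B)) ([A] @ []) B (LolliL (Pass (Ax A)) (Ax B))
      (under_lolliR (LolliL (under_lolliR Pass (ax_nf A))) (ax_nf B))"
    using Lolli by (intro deriv_cong_LolliL_nf deriv_cong_Pass_nf)
  then show ?case
    by (auto intro!: deriv_cong.trans[OF deriv_cong.ax_lolli] deriv_cong.lolliR)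
qed

lemma deriv_cong_norm: "derives S \<Gamma> A f \<Longrightarrow> deriv_cong S \<Gamma> A f (norm f)"
  by (induction rule: derives.induct)
    (auto intro: deriv_cong_ax_nf deriv_cong_Pass_nf deriv_cong_LolliL_nf deriv_cong.lolliR
      deriv_cong_UnitL_nf deriv_cong_TensorL_nf deriv_cong_TensorR_tensorR_nf
      deriv_cong.refl derives.unitR)

lemma derives_norm: "derives S \<Gamma> A f \<Longrightarrow> derives S \<Gamma> A (norm f)"
  using deriv_cong_norm deriv_cong_derives by blast

section \<open>Normal trees as representatives of the congruence classes\<close>

lemma nf_ax_nf: "nf None (ax_nf A)"
proof (induction A)
  case (Tensor A B)
  then show ?case
    using deriv_cong_derives[OF deriv_cong_ax_nf[of A]]
    by (auto intro!: nf_under_lolliR nf_tensorR_nf)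
qed (auto intro!: nf_under_lolliR)

lemma nf_norm: "derives S \<Gamma> A f \<Longrightarrow> nf None (norm f)"
proof (induction rule: derives.induct)
  case (tensorR S \<Gamma> A f \<Delta> B g)
  then show ?case by (auto intro!: nf_tensorR_nf derives_norm)
qed (auto intro!: nf_under_lolliR nf_ax_nf)

text \<open>In a normal tree the premises leave \<open>under_lolliR\<close> nothing to traverse, and
  \<open>tensorR_nf 0\<close> is blocked. The parameter \<open>x\<close> varies since \<otimes>R
  changes it.\<close>

lemma norm_nf: "\<lbrakk>derives S \<Gamma> A f; nf x f\<rbrakk> \<Longrightarrow> norm f = f"
proof (induction arbitrary: x rule: derives.induct)
  case (tensorR S \<Gamma> A f \<Delta> B g)
  then show ?case by (auto simp: tensorR_nf_blocked ctx_length_derives)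
qed (auto simp: under_lolliR_eq)

text \<open>Compatibility holds as \<open>norm\<close> is defined rule by rule, and the \<multimap>R
  conversions are the \<open>LolliR\<close> equation of \<open>under_lolliR\<close>. Only the
  conversions of \<otimes>R with left rules need the commutation lemma.\<close>

lemma norm_deriv_cong: "deriv_cong S \<Gamma> A f g \<Longrightarrow> norm f = norm g"
proof (induction rule: deriv_cong.induct)
  case (tensorR_pass A' \<Gamma> A f \<Delta> B g)
  then show ?case
    by (auto intro!: tensorR_nf_under_lolliR derives_norm)
next
  case (tensorR_unitL \<Gamma> A f \<Delta> B g)
  then show ?case
    by (auto intro!: tensorR_nf_under_lolliR derives_norm)
next
  case (tensorR_tensorL A' B' \<Gamma> A f \<Delta> B g)
  then show ?case
    by (auto intro!: tensorR_nf_under_lolliR derives_norm)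
next
  case (tensorR_lolliL \<Gamma> A' f B' \<Delta> A g \<Lambda> B h)
  then show ?case
    by (auto intro!: tensorR_nf_under_lolliR derives_norm)
qed (auto simp: under_lolliR_eq)

lemma bij_betw_deriv_cong_classes:
  "bij_betw (\<lambda>f. deriv_cong_rel S \<Gamma> A `` {f}) {f. derives S \<Gamma> A f \<and> nf None f}
    (derivations S \<Gamma> A // deriv_cong_rel S \<Gamma> A)"
proof (rule bij_betw_imageI)
  let ?R = "deriv_cong_rel S \<Gamma> A"
  show "inj_on (\<lambda>f. ?R `` {f}) {f. derives S \<Gamma> A f \<and> nf None f}"
  proof (rule inj_onI)
    fix f g
    assume *: "f \<in> {f. derives S \<Gamma> A f \<and> nf None f}" "g \<in> {f. derives S \<Gamma> A f \<and> nf None f}"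
      "?R `` {f} = ?R `` {g}"
    then have "deriv_cong S \<Gamma> A f g"
      using eq_equiv_class_iff[OF equiv_deriv_cong_rel, of f S \<Gamma> A g]
      by (auto simp: derivations_def deriv_cong_rel_def)
    from norm_deriv_cong[OF this] show "f = g" using * by (auto simp: norm_nf)
  qed
  have "?R `` {f} = ?R `` {norm f}" if "derives S \<Gamma> A f" for f
    using deriv_cong_norm[OF that]
    by (intro equiv_class_eq[OF equiv_deriv_cong_rel]) (simp add: deriv_cong_rel_def)
  then show "(\<lambda>f. ?R `` {f}) ` {f. derives S \<Gamma> A f \<and> nf None f} = derivations S \<Gamma> A // ?R"
    by (auto simp: quotient_def derivations_def intro: derives_norm nf_norm)
qed

section \<open>Focused derivations as normal derivations\<close>

primrec unfocus :: "'a fderiv \<Rightarrow> 'a deriv" where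
  "unfocus (FLolliR f) = LolliR (unfocus f)"
| "unfocus (LI2RI f) = unfocus f"
| "unfocus (FUnitL f) = UnitL (unfocus f)"
| "unfocus (FTensorL f) = TensorL (unfocus f)"
| "unfocus (P2LI f) = unfocus f"
| "unfocus (FPass x \<Gamma> f) = Pass (unfocus f)"
| "unfocus (F2P f) = unfocus f"
| "unfocus (FAx x X) = Ax (At X)"
| "unfocus (FUnitR x) = UnitR"
| "unfocus (FTensorR x \<Gamma> \<Delta> f g) = TensorR (unfocus f) (unfocus g)"
| "unfocus (FLolliL x \<Gamma> \<Delta> f g) = LolliL (unfocus f) (unfocus g)"

section \<open>Tags as a number of old formulae\<close>

text \<open>The parameter of \<open>nf\<close> for a focused sequent: in a tagged sequent
  \<multimap>R adds tagged formulae, so the untagged ones are the old ones.\<close>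

definition old_count :: "tag \<Rightarrow> 'a tctx \<Rightarrow> nat option" where
  "old_count x \<Gamma> = (if x then Some (length (filter (\<lambda>D. \<not> snd D) \<Gamma>)) else None)"

lemma map_fst_untagged [simp]: "map fst (untagged \<Gamma>) = \<Gamma>"
  by (simp add: untagged_def comp_def)

lemma map_fst_erase [simp]: "map fst (erase \<Gamma>) = map fst \<Gamma>"
  by (simp add: erase_def)

lemma old_count_False [simp]: "old_count False \<Gamma> = None"
  by (simp add: old_count_def)

lemma old_count_erase [simp]: "old_count True (erase \<Gamma>) = Some (length \<Gamma>)"
  by (simp add: old_count_def erase_def untagged_def comp_def)

lemma old_count_snoc [simp]: "old_count x (\<Gamma> @ [(A, x)]) = old_count x \<Gamma>"
  by (simp add: old_count_def)

lemma untagged_Cons: "untagged (A # \<Gamma>) = (A, False) # untagged \<Gamma>"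
  by (simp add: untagged_def)

lemma wf_tctx_erase [simp]: "wf_tctx x (erase \<Gamma>)"
proof -
  have "erase \<Gamma> = untagged (map fst \<Gamma>) @ tagged []"
    by (simp add: erase_def tagged_def)
  then show ?thesis unfolding wf_tctx_def by (metis append_Nil2 list.map_disc_iff tagged_def)
qed

text \<open>Since \<open>False < True\<close>, putting untagged formulae before tagged ones means
  sorting by tag.\<close>

lemma wf_tctx_True_iff: "wf_tctx True \<Gamma> \<longleftrightarrow> sorted (map snd \<Gamma>)"
proof
  assume "wf_tctx True \<Gamma>"
  then show "sorted (map snd \<Gamma>)"
    by (auto simp: wf_tctx_def untagged_def tagged_def sorted_append comp_def map_replicate_const)
next
  assume "sorted (map snd \<Gamma>)"
  then show "wf_tctx True \<Gamma>"
  proof (induction \<Gamma>)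
    case Nil
    show ?case by (simp add: wf_tctx_def untagged_def tagged_def)
  next
    case (Cons D \<Gamma>)
    obtain A b where D: "D = (A, b)" by fastforce
    show ?case
    proof (cases b)
      case True
      with Cons.prems have "\<forall>E \<in> set \<Gamma>. snd E" by (auto simp: D)
      then have "\<Gamma> = tagged (map fst \<Gamma>)"
        by (auto simp: tagged_def intro!: map_idI[symmetric] prod_eqI)
      with True have "D # \<Gamma> = untagged [] @ tagged (A # map fst \<Gamma>)"
        by (simp add: D untagged_def tagged_def)
      then show ?thesis unfolding wf_tctx_def by metis
    next
      case False
      from Cons obtain \<Gamma>\<^sub>1 \<Gamma>\<^sub>2 where "\<Gamma> = untagged \<Gamma>\<^sub>1 @ tagged \<Gamma>\<^sub>2"
        by (auto simp: wf_tctx_def)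
      with False have "D # \<Gamma> = untagged (A # \<Gamma>\<^sub>1) @ tagged \<Gamma>\<^sub>2"
        by (simp add: D untagged_def)
      then show ?thesis unfolding wf_tctx_def by metis
    qed
  qed
qed

lemma wf_tctx_snoc: "wf_tctx x \<Gamma> \<Longrightarrow> wf_tctx x (\<Gamma> @ [(A, x)])"
proof (cases x)
  case True
  then show "wf_tctx x \<Gamma> \<Longrightarrow> ?thesis" by (simp add: wf_tctx_True_iff sorted_append)
next
  case False
  have "untagged \<Delta> @ [(A, False)] = untagged (\<Delta> @ [A])" for \<Delta>
    by (simp add: untagged_def)
  with False show "wf_tctx x \<Gamma> \<Longrightarrow> ?thesis" unfolding wf_tctx_def by metis
qed

lemma old_count_Cons_tagged:
  "wf_tctx True ((A, True) # \<Gamma>) \<Longrightarrow> old_count True ((A, True) # \<Gamma>) = Some 0"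
  by (auto simp: old_count_def wf_tctx_True_iff filter_empty_conv)

text \<open>Translates the side condition of the focused \<multimap>L into that of
  \<open>nf\<close>. A tag in \<Gamma> forces all of \<Delta> to be tagged, so the untagged formulae
  lie in \<Gamma> without exhausting it.\<close>

lemma old_count_append_less_iff:
  assumes "wf_tctx True (\<Gamma> @ \<Delta>)"
  shows "(\<forall>m. old_count True (\<Gamma> @ \<Delta>) = Some m \<longrightarrow> m < length \<Gamma>)
    \<longleftrightarrow> (\<exists>D. (D, True) \<in> set \<Gamma>)"
proof
  assume "\<exists>D. (D, True) \<in> set \<Gamma>"
  then obtain D where D: "(D, True) \<in> set \<Gamma>" ..
  with assms have "\<forall>E \<in> set \<Delta>. snd E"
    by (auto simp: wf_tctx_True_iff sorted_append) force
  then have "filter (\<lambda>D. \<not> snd D) \<Delta> = []" by (auto simp: filter_empty_conv)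
  moreover have "length (filter (\<lambda>D. \<not> snd D) \<Gamma>) < length \<Gamma>"
    using D by (intro length_filter_less[of "(D, True)"]) auto
  ultimately show "\<forall>m. old_count True (\<Gamma> @ \<Delta>) = Some m \<longrightarrow> m < length \<Gamma>"
    by (simp add: old_count_def)
next
  assume less: "\<forall>m. old_count True (\<Gamma> @ \<Delta>) = Some m \<longrightarrow> m < length \<Gamma>"
  show "\<exists>D. (D, True) \<in> set \<Gamma>"
  proof (rule ccontr)
    assume "\<nexists>D. (D, True) \<in> set \<Gamma>"
    then have "filter (\<lambda>D. \<not> snd D) \<Gamma> = \<Gamma>" by (auto simp: filter_id_conv)
    with less show False by (simp add: old_count_def)
  qed
qed

section \<open>From focused derivations to normal trees\<close>

lemma unfocus_sound:
  "fderives ph x S \<Gamma> C f \<Longrightarrow>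
    derives S (map fst \<Gamma>) C (unfocus f) \<and> nf (old_count x \<Gamma>) (unfocus f)
    \<and> (ph \<noteq> Ph_RI \<longrightarrow> \<not> is_lolliR (unfocus f))"
proof (induction rule: fderives.induct)
  case (pass x A \<Gamma> C f)
  then show ?case
    by (cases x) (auto simp: old_count_Cons_tagged intro: derives.pass)
next
  case (tensorR x \<Gamma> \<Delta> T A f B g)
  then show ?case
    by (auto simp: ctx_length_derives intro: derives.tensorR)
next
  case (lolliL x \<Gamma> \<Delta> C A f B g)
  then show ?case
    using old_count_append_less_iff[of \<Gamma> \<Delta>]
    by (cases x) (auto simp: ctx_length_derives intro: derives.lolliL)
qed (auto intro: derives.intros)

lemma ctx_length_unfocus: "fderives ph x S \<Gamma> C f \<Longrightarrow> ctx_length (unfocus f) = length \<Gamma>"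
  using unfocus_sound ctx_length_derives by fastforce

text \<open>The last focused rule is recoverable: the succedent separates \<open>FLolliR\<close>
  from \<open>LI2RI\<close>, the stoup separates \<open>P2LI\<close> from the left rules, and the
  root of the unfocused tree separates \<open>FPass\<close> from \<open>F2P\<close>.\<close>

lemma unfocus_inject:
  "\<lbrakk>fderives ph x S \<Gamma> C f; fderives ph x S \<Gamma> C g; unfocus f = unfocus g\<rbrakk> \<Longrightarrow> f = g"
proof (induction arbitrary: g rule: fderives.induct)
  case lolliR
  from lolliR.prems show ?case
    by (cases rule: fderives.cases) (auto simp: pos_def dest: lolliR.IH)
next
  case li2ri
  from li2ri.prems li2ri.hyps show ?case
    by (cases rule: fderives.cases) (auto simp: pos_def dest: li2ri.IH)
next
  case unitL
  from unitL.prems show ?case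
    by (cases rule: fderives.cases) (auto simp: neg_stoup_def dest: unitL.IH)
next
  case tensorL
  from tensorL.prems show ?case
    by (cases rule: fderives.cases) (auto simp: neg_stoup_def dest: tensorL.IH)
next
  case p2li
  from p2li.prems p2li.hyps show ?case
    by (cases rule: fderives.cases) (auto simp: neg_stoup_def dest: p2li.IH)
next
  case pass
  from pass.prems show ?case
    by (cases rule: fderives.cases) (auto dest: pass.IH elim: fderives.cases)
next
  case f2p
  from f2p.prems f2p.hyps show ?case
    by (cases rule: fderives.cases) (auto dest: f2p.IH elim: fderives.cases)
next
  case ax
  then show ?case by (cases rule: fderives.cases) auto
next
  case unitR
  then show ?case by (cases rule: fderives.cases) auto
next
  case (tensorR x \<Gamma> \<Delta> T A f\<^sub>1 B f\<^sub>2 g)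
  note hyps = tensorR.hyps and IH = tensorR.IH and unfocus_eq = tensorR.prems(2)
  from tensorR.prems(1) show ?case
  proof (cases rule: fderives.cases)
    case (tensorR \<Gamma>' \<Delta>' g\<^sub>1 g\<^sub>2)
    then have eq: "unfocus f\<^sub>1 = unfocus g\<^sub>1" "unfocus f\<^sub>2 = unfocus g\<^sub>2"
      using unfocus_eq by simp_all
    \<comment> \<open>The unfocused first premise knows its context length, which fixes where the
      conclusion's context is split.\<close>
    then have "length (erase \<Gamma>) = length (erase \<Gamma>')"
      using hyps tensorR by (metis ctx_length_unfocus)
    then have "\<Gamma> = \<Gamma>' \<and> \<Delta> = \<Delta>'"
      using tensorR by (simp add: erase_def untagged_def)
    then show ?thesis using tensorR eq IH(1)[of g\<^sub>1] IH(2)[of g\<^sub>2] by simp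
  qed (use unfocus_eq in auto)
next
  case (lolliL x \<Gamma> \<Delta> C A f\<^sub>1 B f\<^sub>2 g)
  note hyps = lolliL.hyps and IH = lolliL.IH and unfocus_eq = lolliL.prems(2)
  from lolliL.prems(1) show ?case
  proof (cases rule: fderives.cases)
    case (lolliL \<Gamma>' \<Delta>' g\<^sub>1 g\<^sub>2)
    then have eq: "unfocus f\<^sub>1 = unfocus g\<^sub>1" "unfocus f\<^sub>2 = unfocus g\<^sub>2"
      using unfocus_eq by simp_all
    then have "length (erase \<Gamma>) = length (erase \<Gamma>')"
      using hyps lolliL by (metis ctx_length_unfocus)
    then have "\<Gamma> = \<Gamma>' \<and> \<Delta> = \<Delta>'"
      using lolliL by (simp add: erase_def untagged_def)
    then show ?thesis using lolliL eq IH(1)[of g\<^sub>1] IH(2)[of g\<^sub>2] by simp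
  qed (use unfocus_eq in auto)
qed

section \<open>From normal trees to focused derivations\<close>

lemma fderives_RI_exists:
  assumes "\<exists>F. fderives (if is_lolliR f then Ph_RI else Ph_LI) x S \<Gamma> C F \<and> unfocus F = f"
    and "\<not> is_lolliR f \<Longrightarrow> pos C"
  shows "\<exists>F. fderives Ph_RI x S \<Gamma> C F \<and> unfocus F = f"
proof (cases "is_lolliR f")
  case False
  with assms obtain F where "fderives Ph_LI x S \<Gamma> C F" "unfocus F = f" by auto
  then show ?thesis
    using assms(2)[OF False] by (intro exI[of _ "LI2RI F"]) (simp add: fderives.li2ri)
qed (use assms(1) in simp)

text \<open>The phase is read off the root, because left rules need a premise in LI; premises in RI
  are obtained afterwards through \<open>LI2RI\<close>.\<close>

lemma focus_exists:
  assumes "derives S \<Delta> C f" "\<Delta> = map fst \<Gamma>" "wf_tctx x \<Gamma>" "nf (old_count x \<Gamma>) f"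
  shows "\<exists>F. fderives (if is_lolliR f then Ph_RI else Ph_LI) x S \<Gamma> C F \<and> unfocus F = f"
  using assms
proof (induction arbitrary: x \<Gamma> rule: derives.induct)
  case (ax A)
  then obtain X where "A = At X" "\<Gamma> = []" by auto
  then have "fderives Ph_LI x (Some A) \<Gamma> A (P2LI (F2P (FAx x X)))"
    by (auto intro!: fderives.intros simp: neg_stoup_def pos_def)
  with \<open>A = At X\<close> show ?case by (intro exI[of _ "P2LI (F2P (FAx x X))"]) simp
next
  case (pass A \<Delta> C f)
  then obtain \<Gamma>' y where \<Gamma>: "\<Gamma> = (A, y) # \<Gamma>'" "\<Delta> = map fst \<Gamma>'" by auto
  \<comment> \<open>For a tagged sequent \<open>nf\<close> demands that no old formula is left, so
    the head carries the tag; otherwise \<open>wf_tctx\<close> excludes tags.\<close>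
  have y: "y = x"
    using pass.prems \<Gamma>
    by (cases x) (auto simp: old_count_def wf_tctx_def untagged_def split: if_splits)
  obtain F where "fderives Ph_LI False (Some A) (erase \<Gamma>') C F" "unfocus F = f"
    using pass.IH[of "erase \<Gamma>'" False] pass.prems \<Gamma> by auto
  then have "fderives Ph_LI x None \<Gamma> C (P2LI (FPass x \<Gamma>' F))"
    using pass.prems \<Gamma> y
    by (auto intro!: fderives.intros simp: neg_stoup_def dest: fderives_wf)
  with \<open>unfocus F = f\<close> show ?case by (intro exI[of _ "P2LI (FPass x \<Gamma>' F)"]) simp
next
  case (lolliL \<Gamma>\<^sub>1 A f B \<Gamma>\<^sub>2 C g)
  obtain \<Delta> \<Lambda> where \<Gamma>: "\<Gamma> = \<Delta> @ \<Lambda>" "\<Gamma>\<^sub>1 = map fst \<Delta>" "\<Gamma>\<^sub>2 = map fst \<Lambda>"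
    using lolliL.prems(1) by (metis map_eq_append_conv)
  obtain G where G: "fderives Ph_LI False (Some B) (erase \<Lambda>) C G" "unfocus G = g"
    using lolliL.IH(2)[of "erase \<Lambda>" False] lolliL.prems \<Gamma> by auto
  obtain F where F: "fderives Ph_RI False None (erase \<Delta>) A F" "unfocus F = f"
    using fderives_RI_exists[OF lolliL.IH(1)[of "erase \<Delta>" False]] lolliL.prems \<Gamma>
      nf_pos[OF lolliL.hyps(1)] by auto
  have "x \<longrightarrow> (\<exists>D. (D, True) \<in> set \<Delta>)"
    using lolliL.prems \<Gamma> ctx_length_derives[OF lolliL.hyps(1)]
      old_count_append_less_iff[of \<Delta> \<Lambda>] by (cases x) auto
  then have "fderives Ph_LI x (Some (A -\<circ> B)) \<Gamma> C (P2LI (F2P (FLolliL x \<Delta> \<Lambda> F G)))"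
    using lolliL.prems(2) \<Gamma> F G
    by (auto intro!: fderives.intros simp: neg_stoup_def dest: fderives_wf)
  then show ?case using F G by (intro exI[of _ "P2LI (F2P (FLolliL x \<Delta> \<Lambda> F G))"]) simp
next
  case (lolliR S \<Delta> A B f)
  obtain F where "fderives Ph_RI x S (\<Gamma> @ [(A, x)]) B F" "unfocus F = f"
    using fderives_RI_exists[OF lolliR.IH[of "\<Gamma> @ [(A, x)]" x]] lolliR.prems
      nf_pos[OF lolliR.hyps] by (auto simp: wf_tctx_snoc)
  then show ?case by (intro exI[of _ "FLolliR F"]) (simp add: fderives.lolliR)
next
  case (unitL \<Delta> C f)
  then have x: "\<not> x" by (simp add: old_count_def split: if_splits)
  with unitL obtain F where "fderives Ph_LI False None \<Gamma> C F" "unfocus F = f"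
    by fastforce
  then have "fderives Ph_LI x (Some \<I>) \<Gamma> C (FUnitL F)"
    using x by (auto intro!: fderives.intros dest: fderives_wf)
  with \<open>unfocus F = f\<close> show ?case by (intro exI[of _ "FUnitL F"]) simp
next
  case (tensorL A B \<Delta> C f)
  then have x: "\<not> x" by (simp add: old_count_def split: if_splits)
  have "map fst ((B, False) # \<Gamma>) = B # \<Delta>" "wf_tctx False ((B, False) # \<Gamma>)"
    using tensorL.prems(1,2) x by (auto simp: wf_tctx_def simp flip: untagged_Cons)
  with tensorL.IH[of "(B, False) # \<Gamma>" False] tensorL.prems(3)
  obtain F where "fderives Ph_LI False (Some A) ((B, False) # \<Gamma>) C F" "unfocus F = f"
    by auto
  then have "fderives Ph_LI x (Some (A \<otimes> B)) \<Gamma> C (FTensorL F)"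
    using x by (auto intro!: fderives.intros dest: fderives_wf)
  with \<open>unfocus F = f\<close> show ?case by (intro exI[of _ "FTensorL F"]) simp
next
  case unitR
  then have "fderives Ph_LI x None \<Gamma> \<I> (P2LI (F2P (FUnitR x)))"
    by (auto intro!: fderives.intros simp: neg_stoup_def pos_def)
  then show ?case by (intro exI[of _ "P2LI (F2P (FUnitR x))"]) simp
next
  case (tensorR S \<Gamma>\<^sub>1 A f \<Gamma>\<^sub>2 B g)
  obtain \<Delta> \<Lambda> where \<Gamma>: "\<Gamma> = \<Delta> @ \<Lambda>" "\<Gamma>\<^sub>1 = map fst \<Delta>" "\<Gamma>\<^sub>2 = map fst \<Lambda>"
    using tensorR.prems(1) by (metis map_eq_append_conv)
  \<comment> \<open>In the first premise all of \<open>\<Delta>\<close> is erased, so every formula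
    of it counts as old.\<close>
  have f: "nf (Some (length \<Delta>)) f"
    using tensorR.prems \<Gamma> ctx_length_derives[OF tensorR.hyps(1)] by simp
  obtain F where F: "fderives Ph_RI True S (erase \<Delta>) A F" "unfocus F = f"
    using fderives_RI_exists[OF tensorR.IH(1)[of "erase \<Delta>" True]] f \<Gamma>
      nf_pos[OF tensorR.hyps(1) f] by auto
  obtain G where G: "fderives Ph_RI False None (erase \<Lambda>) B G" "unfocus G = g"
    using fderives_RI_exists[OF tensorR.IH(2)[of "erase \<Lambda>" False]] tensorR.prems \<Gamma>
      nf_pos[OF tensorR.hyps(2)] by auto
  have "fderives Ph_LI x S \<Gamma> (A \<otimes> B) (P2LI (F2P (FTensorR x \<Delta> \<Lambda> F G)))"
    using tensorR.prems(2) \<Gamma> F G nf_neg_stoup[OF tensorR.hyps(1) f]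
    by (auto intro!: fderives.intros simp: pos_def)
  then show ?case using F G by (intro exI[of _ "P2LI (F2P (FTensorR x \<Delta> \<Lambda> F G))"]) simp
qed

lemma bij_betw_unfocus:
  "bij_betw unfocus (fderivations Ph_RI False S (untagged \<Gamma>) A) {f. derives S \<Gamma> A f \<and> nf None f}"
proof (rule bij_betw_imageI)
  show "inj_on unfocus (fderivations Ph_RI False S (untagged \<Gamma>) A)"
    by (auto simp: fderivations_def intro: inj_onI unfocus_inject)
  have "\<exists>F. fderives Ph_RI False S (untagged \<Gamma>) A F \<and> unfocus F = f"
    if f: "derives S \<Gamma> A f" "nf None f" for f
  proof -
    have "wf_tctx False (untagged \<Gamma>)" by (auto simp: wf_tctx_def)
    from fderives_RI_exists[OF focus_exists[OF f(1) _ this] nf_pos[OF f]] f(2) show ?thesis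
      by simp
  qed
  then show "unfocus ` fderivations Ph_RI False S (untagged \<Gamma>) A = {f. derives S \<Gamma> A f \<and> nf None f}"
    by (auto simp: fderivations_def dest: unfocus_sound)
qed

theorem theorem4p1:
  fixes S :: "'a stoup" and \<Gamma> :: "'a ctx" and A :: "'a fma"
  shows "\<exists>\<phi>. bij_betw \<phi>
    (derivations S \<Gamma> A // deriv_cong_rel S \<Gamma> A)
    (fderivations Ph_RI False S (untagged \<Gamma>) A)"
  \<comment> \<open>The composite runs from focused derivations over normal trees to classes; the
    bijection sought is its inverse.\<close>
  using bij_betw_trans[OF bij_betw_unfocus bij_betw_deriv_cong_classes] bij_betw_inv_into
  by blast

end
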